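(* Let $q$ be a prime power, let $n,t,u$ be positive integers with $\gcd(u,n)=1$, and let $\sigma\colon x\mapsto x^{q^u}$, an automorphism of $\mathbb{F}_{q^{nt}}$ (whose restriction generates $\mathrm{Gal}(\mathbb{F}_{q^n}\colon\mathbb{F}_q)$). Let $b_0,\dots,b_{t-1}\in\mathbb{F}_{q^{nt}}$ and \[ f(x)=-x+b_0x^{\sigma}+b_1x^{\sigma q^n}+b_2x^{\sigma q^{2n}}+\cdots+b_{t-1}x^{\sigma q^{n(t-1)}}. \] Let $\tau=\sigma^{-1}$, and let $s$ be the minimum integer such that $1\le s\le nt$ and $\tau\colon x\mapsto x^{q^s}$ on $\mathbb{F}_{q^{nt}}$. Let \[ J=\begin{pmatrix}0&1&0&\cdots&0&0\\0&0&1&\cdots&0&0\\ \vdots&\vdots&&&\vdots&\vdots\\0&0&0&\cdots&0&1\\1&0&0&\cdots&0&0\end{pmatrix},\qquad D=\begin{pmatrix}b_0&b_1&\cdots&b_{t-1}\\ b_{t-1}^{q^n}&b_0^{q^n}&\cdots&b_{t-2}^{q^n}\\ \vdots&\vdots&&\vdots\\ b_1^{q^{n(t-1)}}&b_2^{q^{n(t-1)}}&\cdots&b_0^{q^{n(t-1)}}\end{pmatrix} \] be $t\times t$ matrices over $\mathbb{F}_{q^{nt}}$. Then, for every integer $h$, $\dim_{\mathbb{F}_q}\ker f=h$ if and only if \[ \mathrm{rk}\left(D^{\tau^{n-1}}\cdot D^{\tau^{n-2}}\cdots D^{\tau}\cdot D-J^s\right)=t-h. \]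
   Context: Notation: $x^{\sigma q^{ni}}:=x^{q^{u+ni}}$. $\ker f$ is the set of roots of $f$ in $\mathbb{F}_{q^{nt}}$, an $\mathbb{F}_q$-subspace. For a matrix $M$ over $\mathbb{F}_{q^{nt}}$ and an automorphism $\rho$ of $\mathbb{F}_{q^{nt}}$, $M^{\rho}$ is the matrix obtained by applying $\rho$ to each entry. With rows and columns indexed by $0,\dots,t-1$, the $(i,j)$ entry of $D$ is $b_{j-i}^{q^{ni}}$ (index of $b$ modulo $t$), and the $(i,j)$ entry of $J$ is $1$ if $j\equiv i+1\pmod t$ and $0$ otherwise. *)

theory Defs
  imports
    "HOL-Algebra.Embedded_Algebras"
    "HOL-Computational_Algebra.Polynomial"
    "HOL-Number_Theory.Prime_Powers"
    "Jordan_Normal_Form.DL_Rank"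
begin

definition frob :: "nat \<Rightarrow> nat \<Rightarrow> 'a::field \<Rightarrow> 'a" where
  "frob q k x = x ^ (q ^ k)"

definition sigma_poly :: "nat \<Rightarrow> nat \<Rightarrow> nat \<Rightarrow> nat \<Rightarrow> (nat \<Rightarrow> 'a::field) \<Rightarrow> 'a poly" where
  "sigma_poly q n t u b = - monom 1 1 + (\<Sum>i<t. monom (b i) (q ^ (u + n * i)))"

definition ker_poly :: "'a::field poly \<Rightarrow> 'a set" where
  "ker_poly f = {x. poly f x = 0}"

text \<open>For \<open>i, j < t\<close> the index \<open>(j + t - i) mod t\<close> is \<open>j - i\<close> modulo \<open>t\<close>, written so that
  the subtraction on the natural numbers does not truncate.\<close>

definition D_mat :: "nat \<Rightarrow> nat \<Rightarrow> nat \<Rightarrow> (nat \<Rightarrow> 'a::field) \<Rightarrow> 'a mat" where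
  "D_mat q n t b = mat t t (\<lambda>(i, j). (b ((j + t - i) mod t)) ^ (q ^ (n * i)))"

definition J_mat :: "nat \<Rightarrow> 'a::field mat" where
  "J_mat t = mat t t (\<lambda>(i, j). if j mod t = (i + 1) mod t then 1 else 0)"

text \<open>\<open>twisted_prod \<tau> D k\<close> is the product
  \<open>D\<^bsup>\<tau>^(k-1)\<^esup> \<cdots> D\<^bsup>\<tau>\<^esup> D\<close>, the factors with higher powers of \<open>\<tau>\<close> standing on the left.\<close>

primrec twisted_prod :: "('a::field \<Rightarrow> 'a) \<Rightarrow> 'a mat \<Rightarrow> nat \<Rightarrow> 'a mat" where
  "twisted_prod \<tau> D 0 = 1\<^sub>m (dim_row D)"
| "twisted_prod \<tau> D (Suc k) = map_mat (\<tau> ^^ k) D * twisted_prod \<tau> D k"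

end

theory Submission
  imports Defs "HOL-Number_Theory.Residues"
begin

text \<open>For \<open>y = x\<^bsup>\<sigma>\<^esup>\<close> let \<open>v(y)\<close> be the column \<open>(y, y\<^bsup>q^n\<^esup>, y\<^bsup>q^2n\<^esup>, \<dots>)\<close>. Then \<open>f(x) = 0\<close> means
  \<open>D v(y) = \<tau>(v(y))\<close>, that is, \<open>v(y)\<close> is fixed by the \<open>\<sigma>\<close>-semilinear map \<open>\<Psi> w = \<sigma>(D w)\<close>. The columns
  \<open>v(y)\<close> are the fixed vectors of the semilinear map \<open>\<rho>\<close> that applies \<open>x \<mapsto> x\<^bsup>q^n\<^esup>\<close> and shifts the
  coordinates cyclically, and \<open>\<rho>\<close> commutes with \<open>\<Psi>\<close>. The kernel of the matrix of the theorem is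
  \<open>V = {w. \<Psi>\<^sup>n w = \<rho>\<^sup>u w}\<close>. As \<open>u\<close> and \<open>n\<close> are coprime, some \<open>\<Theta> = \<Psi>\<^sup>a \<rho>\<^sup>c\<close> is semilinear for \<open>x \<mapsto> x\<^sup>q\<close>;
  on \<open>V\<close> it satisfies \<open>\<Theta>\<^sup>n = \<rho>\<close>, \<open>\<Theta>\<^sup>u = \<Psi>\<close> and \<open>\<Theta>\<close> has order dividing \<open>nt\<close>. By Galois descent, \<open>V\<close> is spanned
  over the large field by the fixed space of \<open>\<Theta>\<close>, which is a copy of \<open>ker f\<close>, so
  \<open>dim V = dim ker f\<close>. Descent is proved by counting: Artin's independence argument bounds \<open>|V|\<close>
  from below, and the trace \<open>\<Sum>\<^sub>k c\<^bsup>q^k\<^esup> \<Theta>\<^sup>k w\<close> bounds it from above.\<close>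

section \<open>Frobenius maps and linear algebra over a subfield\<close>

text \<open>Multiplication by a nonzero \<open>x\<close> permutes the nonzero elements of
  \<open>K\<close>; comparing the products over all of them gives Fermat's identity. It is applied
  to the subfield and to the whole field.\<close>

lemma power_card_eq_self:
  fixes x :: "'a::field"
  assumes "finite K" "0 \<in> K" and mult: "\<And>x y. x \<in> K \<Longrightarrow> y \<in> K \<Longrightarrow> x * y \<in> K" and "x \<in> K"
  shows "x ^ card K = x"
proof (cases "x = 0")
  case True
  then show ?thesis
    using assms by (auto simp: power_0_left card_gt_0_iff)
next
  case False
  have inj: "inj_on ((*) x) (K - {0})"
    using False by (auto simp: inj_on_def)
  have "(*) x ` (K - {0}) \<subseteq> K - {0}"
    using mult assms(4) False by auto
  then have img: "(*) x ` (K - {0}) = K - {0}"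
    using inj assms(1) by (simp add: endo_inj_surj)
  have "(\<Prod>y\<in>K - {0}. y) = (\<Prod>y\<in>K - {0}. x * y)"
    using prod.reindex[OF inj, of "\<lambda>y. y"] img by simp
  also have "\<dots> = x ^ card (K - {0}) * (\<Prod>y\<in>K - {0}. y)"
    by (simp add: prod.distrib)
  finally have "x ^ card (K - {0}) = 1"
    using assms(1) by simp
  moreover have "card K = Suc (card (K - {0}))"
    using assms(1,2) by (metis card.remove)
  ultimately show ?thesis by simp
qed

text \<open>Additivity and twisted homogeneity in one condition on finite combinations; the empty
  one gives \<open>F 0 = 0\<close>. The twist is recorded by its exponent \<open>e\<close>, so
  composition adds exponents.\<close>

definition semilinear :: "nat \<Rightarrow> nat \<Rightarrow> (('i \<Rightarrow> 'a::field) \<Rightarrow> 'i \<Rightarrow> 'a) \<Rightarrow> bool" where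
  "semilinear q e F \<longleftrightarrow> (\<forall>(N::nat) c w.
     F (\<lambda>i. \<Sum>k<N. c k * w k i) = (\<lambda>i. \<Sum>k<N. frob q e (c k) * F (w k) i))"

lemma semilinearD:
  "semilinear q e F \<Longrightarrow> F (\<lambda>i. \<Sum>k<(N::nat). c k * w k i) = (\<lambda>i. \<Sum>k<N. frob q e (c k) * F (w k) i)"
  by (simp add: semilinear_def)

lemma frob_frob: "frob q a (frob q b x) = frob q (a + b) x"
  by (simp add: frob_def power_add mult.commute flip: power_mult)

lemma frob_0 [simp]: "frob q 0 x = x"
  by (simp add: frob_def)

lemma frob_mult: "frob q k (x * y) = frob q k x * frob q k y"
  by (simp add: frob_def power_mult_distrib)

lemma frob_one [simp]: "frob q k 1 = 1"
  by (simp add: frob_def)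

lemma frob_funpow: "(frob q k ^^ j) x = frob q (k * j) x"
  by (induction j) (simp_all add: frob_frob)

lemma semilinear_comp:
  assumes "semilinear q d F" "semilinear q e G"
  shows "semilinear q (d + e) (F \<circ> G)"
  using assms by (simp add: semilinear_def frob_frob)

lemma semilinear_funpow:
  assumes "semilinear q e F"
  shows "semilinear q (k * e) (F ^^ k)"
proof (induction k)
  case 0
  show ?case by (simp add: semilinear_def)
next
  case (Suc k)
  show ?case
    using semilinear_comp[OF assms Suc] by (simp add: comp_def)
qed

lemma semilinear_zero:
  assumes "semilinear q e F"
  shows "F (\<lambda>i. 0) = (\<lambda>i. 0)"
  using semilinearD[OF assms, of _ _ 0] by simp

lemma combine_eq_sum:
  "length Ks = length Us \<Longrightarrow>
    ring.combine (class_ring :: 'a::field ring) Ks Us = (\<Sum>k<length Us. Ks ! k * Us ! k)"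
proof (induction Ks Us rule: list_induct2)
  case Nil
  show ?case
    by (simp add: ring.combine.simps[OF class_ring.ring_axioms])
next
  case (Cons k Ks u Us)
  then show ?case
    by (simp add: ring.combine.simps[OF class_ring.ring_axioms] sum.lessThan_Suc_shift del: sum.lessThan_Suc)
qed

locale finite_field_extension =
  fixes q m :: nat and K :: "'a::{field,finite} set"
  assumes primepow_q: "primepow q" and m_pos: "0 < m"
    and card_UNIV: "card (UNIV :: 'a set) = q ^ m"
    and subfield_K: "subfield K (class_ring :: 'a ring)" and card_K: "card K = q"
begin

lemma q_gt_1: "1 < q"
  using primepow_q by (simp add: primepow_gt_Suc_0)

text \<open>The characteristic divides \<open>q ^ m\<close>, hence equals the prime below
  \<open>q\<close>. This is what makes every \<open>frob q e\<close> additive.\<close>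

lemma q_eq_CHAR_power: obtains k where "q = CHAR('a) ^ k" "prime CHAR('a)"
proof -
  have prime: "prime CHAR('a)"
    by (rule prime_CHAR_semidom) (simp add: finite_imp_CHAR_pos)
  obtain p k where pk: "prime p" "q = p ^ k"
    using primepow_q by (auto simp: primepow_def)
  have "CHAR('a) dvd q ^ m"
    using CHAR_dvd_CARD[where ?'a = 'a] by (simp add: card_UNIV)
  then have "CHAR('a) dvd p"
    using prime pk(2) by (metis prime_dvd_power)
  then have "CHAR('a) = p"
    using prime pk(1) primes_dvd_imp_eq by blast
  then show thesis
    using that pk prime by blast
qed

lemma frob_sum: "frob q e (\<Sum>k\<in>A. f k) = (\<Sum>k\<in>A. frob q e (f k :: 'a))"
proof -
  obtain k where k: "q = CHAR('a) ^ k" "prime CHAR('a)"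
    by (rule q_eq_CHAR_power)
  then have "q ^ e = CHAR('a) ^ (k * e)"
    by (simp add: power_mult)
  then show ?thesis
    unfolding frob_def using freshmans_dream_sum'[OF k(2)] by blast
qed

lemma frob_add: "frob q e (x + y) = frob q e x + frob q e (y :: 'a)"
  using frob_sum[of e "\<lambda>b. if b then x else y" UNIV] by (simp add: UNIV_bool add.commute)

lemma frob_zero [simp]: "frob q e (0 :: 'a) = 0"
  using frob_sum[of e _ "{}"] by simp

lemma frob_minus: "frob q e (- x) = - frob q e (x :: 'a)"
  using frob_add[of e x "-x"] by (simp add: eq_neg_iff_add_eq_0 add.commute)

lemma frob_m [simp]: "frob q m (x :: 'a) = x"
  using power_card_eq_self[of "UNIV :: 'a set" x] by (simp add: frob_def card_UNIV)

lemma frob_mult_m [simp]: "frob q (m * l) (x :: 'a) = x"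
  by (induction l) (simp_all flip: frob_frob)

lemma frob_add_mult_m [simp]: "frob q (e + m * l) (x :: 'a) = frob q e x"
  using frob_frob[of q e "m * l" x] by simp

lemma frob_cancel [simp]: "frob q e x = frob q e y \<longleftrightarrow> x = (y :: 'a)"
proof
  assume "frob q e x = frob q e y"
  \<comment> \<open>The exponent \<open>e * (m - 1)\<close> completes \<open>e\<close> to the
    multiple \<open>m * e\<close> of \<open>m\<close>, so this map is a left inverse.\<close>
  then have "frob q (e * (m - 1)) (frob q e x) = frob q (e * (m - 1)) (frob q e y)"
    by simp
  moreover have "e * (m - 1) + e = m * e"
    using m_pos by (cases m) simp_all
  ultimately show "x = y"
    by (simp add: frob_frob)
qed simp

lemma K_props: "0 \<in> K" "1 \<in> K"
  "x \<in> K \<Longrightarrow> y \<in> K \<Longrightarrow> x * y \<in> K" "x \<in> K \<Longrightarrow> y \<in> K \<Longrightarrow> x + y \<in> K" "x \<in> K \<Longrightarrow> - x \<in> K"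
  using subringE[OF subfieldE(1)[OF subfield_K]] 
  by (auto simp: class_ring_simps)

text \<open>The fixed points are the roots of \<open>X^(q^e) - X\<close>, which is nonzero because
  \<open>1 < q ^ e\<close>.\<close>

lemma card_frob_fixed_le:
  assumes "0 < e"
  shows "card {x :: 'a. frob q e x = x} \<le> q ^ e"
proof -
  let ?p = "monom 1 (q ^ e) - monom 1 1 :: 'a poly"
  have qe: "1 < q ^ e"
    using q_gt_1 assms by (rule one_less_power)
  then have "coeff ?p (q ^ e) = 1"
    by simp
  then have "?p \<noteq> 0"
    by (metis coeff_0 zero_neq_one)
  then have "card {x. poly ?p x = 0} \<le> degree ?p"
    by (rule card_poly_roots_bound)
  also have "degree ?p \<le> q ^ e"
    using qe by (intro degree_diff_le) (auto intro: order.trans[OF degree_monom_le])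
  finally show ?thesis
    by (simp add: frob_def poly_monom)
qed

text \<open>All \<open>q\<close> elements of \<open>K\<close> are fixed and there are at most
  \<open>q\<close> fixed points, so \<open>K\<close> is the whole fixed field.\<close>

lemma frob_1_eq_self_iff: "frob q 1 x = x \<longleftrightarrow> x \<in> K"
proof -
  have "K \<subseteq> {x. frob q 1 x = x}"
    using power_card_eq_self[of K] K_props card_K by (auto simp: frob_def)
  moreover have "card {x :: 'a. frob q 1 x = x} \<le> card K"
    using card_frob_fixed_le[of 1] card_K by simp
  ultimately have "K = {x. frob q 1 x = x}"
    by (intro card_seteq) auto
  then show ?thesis by auto
qed

lemma frob_eq_id:
  assumes "\<And>x :: 'a. frob q e x = x" and "e < m"
  shows "e = 0"
proof (rule ccontr)
  assume "e \<noteq> 0"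
  then have "q ^ m \<le> q ^ e"
    using card_frob_fixed_le[of e] by (simp add: assms(1) card_UNIV)
  then show False
    using assms(2) q_gt_1 by simp
qed

lemma frob_K: "x \<in> K \<Longrightarrow> frob q e x = x"
proof (induction e)
  case (Suc e)
  then show ?case
    using frob_frob[of q 1 e x] frob_1_eq_self_iff[of x] by simp
qed simp

section \<open>Subspaces over \<open>K\<close>: bases and cardinality\<close>

definition K_subspace :: "'a set \<Rightarrow> bool" where
  "K_subspace E \<longleftrightarrow> 0 \<in> E \<and> (\<forall>x\<in>E. \<forall>y\<in>E. x + y \<in> E) \<and> (\<forall>c\<in>K. \<forall>x\<in>E. c * x \<in> E)"

lemma K_subspace_sum:
  assumes "K_subspace E" "\<And>k. k < N \<Longrightarrow> c k \<in> K" "\<And>k. k < N \<Longrightarrow> w k \<in> E"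
  shows "(\<Sum>k<(N::nat). c k * w k) \<in> E"
  using assms(2,3) assms(1) by (induction N) (auto simp: K_subspace_def)

text \<open>Translates the dimension of the algebra library into coordinates given by ordinary sums,
  and into the count \<open>q ^ dim\<close> on which the later arguments rely.\<close>

lemma K_subspace_basis:
  assumes "K_subspace E"
  obtains us where "length us = ring.dim (class_ring :: 'a ring) K E"
    and "set us \<subseteq> E"
    and "\<forall>c. (\<forall>k<length us. c k \<in> K) \<and> (\<Sum>k<length us. c k * us ! k) = 0 \<longrightarrow> (\<forall>k<length us. c k = 0)"
    and "\<forall>x\<in>E. \<exists>c. (\<forall>k<length us. c k \<in> K) \<and> x = (\<Sum>k<length us. c k * us ! k)"
    and "card E = q ^ ring.dim (class_ring :: 'a ring) K E"
proof -
  let ?R = "class_ring :: 'a ring"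
  \<comment> \<open>Since \<open>E\<close> is finite, the list of all its elements serves as a
    spanning family, which gives finite dimension.\<close>
  obtain vs where vs: "set vs = E"
    using finite_list[of E] by auto
  have span_iff: "x \<in> ring.Span ?R K us \<longleftrightarrow>
      (\<exists>Ks. set Ks \<subseteq> K \<and> length Ks = length us \<and> x = (\<Sum>k<length us. Ks ! k * us ! k))" for us x
    using ring.Span_mem_iff_length_version[OF class_ring.ring_axioms subfield_K, of us x] combine_eq_sum[of _ us]
    by (auto simp: class_ring_simps)
  note sum_in = K_subspace_sum[OF assms]
  have "E = ring.Span ?R K vs"
  proof
    show "E \<subseteq> ring.Span ?R K vs"
      using ring.Span_base_incl[OF class_ring.ring_axioms subfield_K, of vs] vs by (simp add: class_ring_simps)
    show "ring.Span ?R K vs \<subseteq> E"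
    proof
      fix x assume "x \<in> ring.Span ?R K vs"
      then obtain Ks where Ks: "set Ks \<subseteq> K" "length Ks = length vs"
        "x = (\<Sum>k<length vs. Ks ! k * vs ! k)"
        using span_iff by blast
      show "x \<in> E"
        unfolding Ks(3) by (rule sum_in) (use Ks(1,2) vs in auto)
    qed
  qed
  then have "ring.finite_dimension ?R K E"
    using ring.Span_finite_dimension[OF class_ring.ring_axioms subfield_K, of vs] by (simp add: class_ring_simps)
  then have "ring.dimension ?R (ring.dim ?R K E) K E"
    using ring.finite_dimensionE[OF class_ring.ring_axioms subfield_K] by (simp add: over_def)
  then obtain us where us: "ring.independent ?R K us" "length us = ring.dim ?R K E"
    "ring.Span ?R K us = E"
    using ring.exists_base[OF class_ring.ring_axioms subfield_K] by blast
  have indep: "c k = 0" if "\<And>k. k < length us \<Longrightarrow> c k \<in> K"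
    "(\<Sum>k<length us. c k * us ! k) = 0" "k < length us" for c k
  proof -
    have "set (take (length us) (map c [0..<length us])) \<subseteq> {\<zero>\<^bsub>?R\<^esub>}"
      by (rule ring.independent_imp_trivial_combine[OF class_ring.ring_axioms subfield_K us(1)])
        (use that in \<open>auto simp: combine_eq_sum\<close>)
    then show ?thesis
      using that(3) by (auto simp: class_ring_simps image_subset_iff)
  qed
  have span: "\<exists>c. (\<forall>k<length us. c k \<in> K) \<and> x = (\<Sum>k<length us. c k * us ! k)" if x: "x \<in> E" for x
  proof -
    obtain Ks where "set Ks \<subseteq> K" "length Ks = length us" "x = (\<Sum>k<length us. Ks ! k * us ! k)"
      using x unfolding us(3)[symmetric] span_iff by blast
    then show ?thesis
      by (intro exI[of _ "(!) Ks"]) auto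
  qed
  have sub: "set us \<subseteq> E"
    using ring.Span_base_incl[OF class_ring.ring_axioms subfield_K, of us] us(3) by (simp add: class_ring_simps)
  let ?h = "length us"
  let ?f = "\<lambda>c. \<Sum>k<?h. c k * us ! k"
  have "bij_betw ?f ({..<?h} \<rightarrow>\<^sub>E K) E"
  proof (rule bij_betwI')
    fix c d assume cd: "c \<in> {..<?h} \<rightarrow>\<^sub>E K" "d \<in> {..<?h} \<rightarrow>\<^sub>E K"
    show "?f c = ?f d \<longleftrightarrow> c = d"
    proof
      assume eq: "?f c = ?f d"
      have "c k - d k = 0" if "k < ?h" for k
      proof (rule indep[OF _ _ that])
        show "c k - d k \<in> K" if "k < ?h" for k
          using that cd K_props(4)[of "c k" "- d k"] K_props(5)[of "d k"] by (auto simp: PiE_iff)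
        show "(\<Sum>k<?h. (c k - d k) * us ! k) = 0"
          using eq by (simp add: left_diff_distrib sum_subtractf)
      qed
      then show "c = d"
        using cd by (intro PiE_ext) auto
    qed simp
  next
    fix c assume "c \<in> {..<?h} \<rightarrow>\<^sub>E K"
    then show "?f c \<in> E"
      using sub by (intro sum_in) auto
  next
    fix x assume "x \<in> E"
    then obtain c where "\<forall>k<?h. c k \<in> K" "x = ?f c"
      using span by blast
    then show "\<exists>c\<in>{..<?h} \<rightarrow>\<^sub>E K. x = ?f c"
      by (intro bexI[of _ "restrict c {..<?h}"]) auto
  qed
  then have "card E = q ^ ?h"
    using bij_betw_same_card by (fastforce simp: card_PiE card_K)
  then have card_E: "card E = q ^ ring.dim ?R K E"
    using us(2) by simp
  show thesis
    by (rule that[OF us(2) sub _ _ card_E]) (use indep span in auto)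
qed

lemma dim_UNIV: "ring.dim (class_ring :: 'a ring) K UNIV = m"
proof -
  have "K_subspace UNIV"
    by (simp add: K_subspace_def)
  then have "q ^ m = q ^ ring.dim (class_ring :: 'a ring) K UNIV"
    using K_subspace_basis card_UNIV by metis
  then show ?thesis
    using q_gt_1 by simp
qed

section \<open>Galois descent for Frobenius-semilinear maps\<close>

text \<open>Artin's argument: normalise one coefficient of a shortest relation to \<open>1\<close>; subtracting its
  image under \<open>\<Theta>\<close> shows that all its coefficients are fixed by the Frobenius map.\<close>

lemma fixed_vectors_independent:
  assumes "semilinear q 1 \<Theta>" "\<And>k. k < (h::nat) \<Longrightarrow> \<Theta> (w k) = w k"
    and indep: "\<And>c k. (\<And>k. k < h \<Longrightarrow> c k \<in> K) \<Longrightarrow> (\<And>i. (\<Sum>k<h. c k * w k i) = 0) \<Longrightarrow>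
      k < h \<Longrightarrow> c k = 0"
    and "\<And>i. (\<Sum>k<h. c k * w k i) = 0" "k < h"
  shows "c k = (0 :: 'a)"
  using assms(2-)
proof (induction h arbitrary: c k)
  case 0
  then show ?case by simp
next
  case (Suc h)
  have IH: "c k = 0" if "\<And>i. (\<Sum>k<h. c k * w k i) = 0" "k < h" for c k
  proof (rule Suc.IH[OF Suc.prems(1)])
    fix d j assume d: "\<And>k. k < h \<Longrightarrow> d k \<in> K" "\<And>i. (\<Sum>k<h. d k * w k i) = 0" "j < h"
    \<comment> \<open>A relation among the first \<open>h\<close> vectors is padded with the
      coefficient \<open>0\<close> at \<open>h\<close>, so that independence of all
      \<open>Suc h\<close> vectors applies.\<close>
    have "(d(h := 0)) j = 0"
      by (rule Suc.prems(2)) (use d K_props(1) in \<open>auto simp: less_Suc_eq\<close>)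
    then show "d j = 0"
      using d(3) by simp
  qed (use that in auto)
  show ?case
  proof (cases "c h = 0")
    case True
    then show ?thesis
      using IH[of c k] Suc.prems(3,4) by (cases "k = h") simp_all
  next
    case False
    define d where "d j = c j / c h" for j
    have d: "(\<Sum>k<Suc h. d k * w k i) = 0" for i
      using Suc.prems(3)[of i] by (simp add: d_def flip: sum_divide_distrib add_divide_distrib)
    have dh: "d h = 1"
      using False by (simp add: d_def)
    have "(\<lambda>i. \<Sum>k<Suc h. frob q 1 (d k) * \<Theta> (w k) i) = \<Theta> (\<lambda>i. 0)"
      using semilinearD[OF assms(1), of d w "Suc h"] by (simp only: d)
    then have "(\<Sum>k<Suc h. frob q 1 (d k) * \<Theta> (w k) i) = 0" for i
      by (simp only: semilinear_zero[OF assms(1)] fun_eq_iff)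
    moreover have "(\<Sum>k<Suc h. frob q 1 (d k) * \<Theta> (w k) i) = (\<Sum>k<Suc h. frob q 1 (d k) * w k i)" for i
      using Suc.prems(1) by (intro sum.cong) auto
    ultimately have "(\<Sum>k<Suc h. frob q 1 (d k) * w k i) - (\<Sum>k<Suc h. d k * w k i) = 0" for i
      using d by simp
    then have "(\<Sum>k<Suc h. (frob q 1 (d k) - d k) * w k i) = 0" for i
      by (simp only: left_diff_distrib sum_subtractf)
    then have "(\<Sum>k<h. (frob q 1 (d k) - d k) * w k i) = 0" for i
      by (simp add: dh)
    then have "frob q 1 (d k) - d k = 0" if "k < h" for k
      using IH[of "\<lambda>k. frob q 1 (d k) - d k"] that by simp
    then have "d k \<in> K" if "k < Suc h" for k
      using that dh K_props(2) frob_1_eq_self_iff[of "d k"] by (auto simp: less_Suc_eq)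
    then have "d h = 0"
      using Suc.prems(2)[of d h] d by simp
    then show ?thesis
      using dh by simp
  qed
qed

text \<open>For \<open>\<Theta>\<close> semilinear of exponent \<open>1\<close>, the summand at
  \<open>k\<close> is \<open>\<Theta> ^^ k\<close> applied to the multiple \<open>c v\<close>; this
  is the sum of its first \<open>m\<close> iterates.\<close>

definition trace_map :: "(('i \<Rightarrow> 'a) \<Rightarrow> 'i \<Rightarrow> 'a) \<Rightarrow> 'a \<Rightarrow> ('i \<Rightarrow> 'a) \<Rightarrow> 'i \<Rightarrow> 'a" where
  "trace_map \<Theta> c v = (\<lambda>i. \<Sum>k<m. frob q k c * (\<Theta> ^^ k) v i)"

text \<open>Applying \<open>\<Theta>\<close> moves each summand to the next, and the summand at
  \<open>m\<close> equals the one at \<open>0\<close>.\<close>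

lemma trace_map_fixed:
  assumes "semilinear q 1 \<Theta>" "(\<Theta> ^^ m) v = v"
  shows "\<Theta> (trace_map \<Theta> c v) = trace_map \<Theta> c v"
proof
  fix i
  let ?g = "\<lambda>k. frob q k c * (\<Theta> ^^ k) v i"
  have "\<Theta> (trace_map \<Theta> c v) i = (\<Sum>k<m. ?g (Suc k))"
    unfolding trace_map_def semilinearD[OF assms(1)] by (simp add: frob_frob)
  also have "?g 0 + \<dots> = (\<Sum>k<m. ?g k) + ?g m"
    by (subst sum.lessThan_Suc_shift[symmetric]) simp
  finally show "\<Theta> (trace_map \<Theta> c v) i = trace_map \<Theta> c v i"
    using assms(2) by (simp add: trace_map_def add.commute)
qed

text \<open>Coefficients from \<open>K\<close> are fixed by Frobenius and can be pulled out. Hence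
  the values at a \<open>K\<close>-basis of the field determine the trace at every
  \<open>c\<close>.\<close>

lemma trace_map_K_linear:
  assumes "\<And>l. l < N \<Longrightarrow> c l \<in> K"
  shows "trace_map \<Theta> (\<Sum>l<N. c l * x l) v i = (\<Sum>l<(N::nat). c l * trace_map \<Theta> (x l) v i)"
proof -
  have "trace_map \<Theta> (\<Sum>l<N. c l * x l) v i =
      (\<Sum>k<m. \<Sum>l<N. c l * (frob q k (x l) * (\<Theta> ^^ k) v i))"
    using assms by (simp add: trace_map_def frob_sum frob_mult frob_K sum_distrib_right mult.assoc)
  also have "\<dots> = (\<Sum>l<N. c l * trace_map \<Theta> (x l) v i)"
    by (subst sum.swap) (simp add: trace_map_def sum_distrib_left)
  finally show ?thesis .
qed

lemma trace_map_diff: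
  assumes "semilinear q 1 \<Theta>"
  shows "trace_map \<Theta> c (\<lambda>i. v i - w i) = (\<lambda>i. trace_map \<Theta> c v i - trace_map \<Theta> c w i)"
proof -
  have "(\<Theta> ^^ k) (\<lambda>i. v i - w i) = (\<lambda>i. (\<Theta> ^^ k) v i - (\<Theta> ^^ k) w i)" for k
    \<comment> \<open>The difference is a combination of two vectors with coefficients
      \<open>1\<close> and \<open>-1\<close>.\<close>
    using semilinearD[OF semilinear_funpow[OF assms, of k],
        of "\<lambda>k. if k = 0 then 1 else -1" "\<lambda>k. if k = 0 then v else w" 2]
    by (simp add: numeral_2_eq_2 frob_minus)
  then show ?thesis
    by (simp add: trace_map_def right_diff_distrib sum_subtractf)
qed

text \<open>As a function of \<open>c\<close>, the trace is a polynomial of degree less than the order of the field.\<close>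

lemma trace_map_nondegenerate:
  assumes "\<And>c. trace_map \<Theta> c v = (\<lambda>i. 0)"
  shows "v = (\<lambda>i. 0)"
proof
  fix i
  define p where "p = (\<Sum>k<m. monom ((\<Theta> ^^ k) v i) (q ^ k))"
  have "poly p c = 0" for c
    using fun_cong[OF assms[of c], of i]
    by (simp add: p_def trace_map_def poly_sum poly_monom frob_def mult.commute)
  then have "{x. poly p x = 0} = UNIV" by auto
  moreover have "degree p < q ^ m"
  proof (rule le_less_trans)
    show "degree p \<le> q ^ (m - 1)"
      unfolding p_def using q_gt_1
      by (intro degree_sum_le) (auto intro!: order.trans[OF degree_monom_le] power_increasing)
    show "q ^ (m - 1) < q ^ m"
      using q_gt_1 m_pos by (intro power_strict_increasing) auto
  qed
  ultimately have "p = 0"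
    using card_poly_roots_bound[of p] card_UNIV by (metis leD)
  \<comment> \<open>Only \<open>k = 0\<close> contributes the exponent \<open>1\<close>, as
    \<open>1 < q\<close>; so the coefficient of \<open>X\<close> is \<open>v i\<close>.\<close>
  moreover have "coeff p 1 = (\<Sum>k<m. if k = 0 then v i else 0)"
    unfolding p_def coeff_sum using q_gt_1 by (intro sum.cong) auto
  ultimately show "v i = 0"
    using m_pos by simp
qed

text \<open>Descent in counted form. Through \<open>L\<close>, a \<open>K\<close>-basis of
  \<open>E\<close> gives fixed vectors independent over the large field, so \<open>V\<close>
  contains all their combinations. Conversely, the traces at a \<open>K\<close>-basis of the field
  embed \<open>V\<close> into the \<open>m\<close>-tuples of fixed vectors.\<close>

lemma card_eq_card_fixed_power:
  assumes "finite V" and lin: "semilinear q 1 \<Theta>"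
    and closed: "\<And>(N::nat) c w. (\<And>k. k < N \<Longrightarrow> w k \<in> V) \<Longrightarrow> (\<lambda>i. \<Sum>k<N. c k * w k i) \<in> V"
    and stable: "\<And>v. v \<in> V \<Longrightarrow> \<Theta> v \<in> V" and order: "\<And>v. v \<in> V \<Longrightarrow> (\<Theta> ^^ m) v = v"
    and E: "K_subspace E" and L: "bij_betw L E {v \<in> V. \<Theta> v = v}"
    and L_lin: "\<And>(N::nat) c x. (\<And>k. k < N \<Longrightarrow> c k \<in> K \<and> x k \<in> E) \<Longrightarrow>
      L (\<Sum>k<N. c k * x k) = (\<lambda>i. \<Sum>k<N. c k * L (x k) i)"
  shows "card V = (q ^ m) ^ ring.dim (class_ring :: 'a ring) K E"
proof (rule antisym)
  let ?h = "ring.dim (class_ring :: 'a ring) K E" and ?F = "{v \<in> V. \<Theta> v = v}"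
  obtain us where us: "length us = ?h" "set us \<subseteq> E"
    "\<forall>c. (\<forall>k<length us. c k \<in> K) \<and> (\<Sum>k<length us. c k * us ! k) = 0 \<longrightarrow> (\<forall>k<length us. c k = 0)"
    and card_E: "card E = q ^ ?h"
    by (rule K_subspace_basis[OF E]) blast
  have us_E: "us ! k \<in> E" if "k < ?h" for k
    using us(1,2) that by auto
  have L0: "L 0 = (\<lambda>i. 0)"
    using L_lin[of 0 "\<lambda>_. 0" "\<lambda>_. 0"] by simp
  have L_fixed: "L x \<in> V" "\<Theta> (L x) = L x" if "x \<in> E" for x
    using bij_betwE[OF L] that by auto
  have indep: "c k = 0" if c: "\<And>i. (\<Sum>k<?h. c k * L (us ! k) i) = 0" and k: "k < ?h" for c k
  proof (rule fixed_vectors_independent[OF lin _ _ c k])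
    fix d j assume d: "\<And>k. k < ?h \<Longrightarrow> d k \<in> K" "\<And>i. (\<Sum>k<?h. d k * L (us ! k) i) = 0" and j: "j < ?h"
    have "L (\<Sum>k<?h. d k * us ! k) = L 0"
      using L_lin[of ?h d "(!) us"] d us_E by (simp add: L0)
    moreover have "(\<Sum>k<?h. d k * us ! k) \<in> E"
      using d(1) us_E E K_props by (intro K_subspace_sum) auto
    ultimately have "(\<Sum>k<?h. d k * us ! k) = 0"
      using L E by (auto simp: bij_betw_def inj_on_def K_subspace_def)
    then show "d j = 0"
      using us(1,3) d(1) j by metis
  qed (use L_fixed us_E in auto)
  have "card ({..<?h} \<rightarrow>\<^sub>E (UNIV :: 'a set)) \<le> card V"
  proof (rule card_inj_on_le[OF _ _ \<open>finite V\<close>])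
    let ?f = "\<lambda>c i. \<Sum>k<?h. c k * L (us ! k) i"
    show "inj_on ?f ({..<?h} \<rightarrow>\<^sub>E UNIV)"
    proof (rule inj_onI)
      fix c d assume cd: "c \<in> {..<?h} \<rightarrow>\<^sub>E UNIV" "d \<in> {..<?h} \<rightarrow>\<^sub>E UNIV" "?f c = ?f d"
      have "c k - d k = 0" if "k < ?h" for k
        using fun_cong[OF cd(3)] that
        by (intro indep[of "\<lambda>k. c k - d k"]) (simp add: left_diff_distrib sum_subtractf)
      then show "c = d"
        using cd(1,2) by (intro PiE_ext) auto
    qed
    show "?f ` ({..<?h} \<rightarrow>\<^sub>E UNIV) \<subseteq> V"
      using closed L_fixed us_E by auto
  qed
  then show "(q ^ m) ^ ?h \<le> card V"
    by (simp add: card_PiE card_UNIV)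
  have UNIV: "K_subspace UNIV"
    by (simp add: K_subspace_def)
  obtain cs where cs: "length cs = m"
    "\<forall>x\<in>UNIV. \<exists>c. (\<forall>k<length cs. c k \<in> K) \<and> x = (\<Sum>k<length cs. c k * cs ! k)"
    unfolding dim_UNIV[symmetric] by (rule K_subspace_basis[OF UNIV]) blast
  have pow_V: "(\<Theta> ^^ k) v \<in> V" if "v \<in> V" for k v
    using that stable by (induction k) auto
  have "card V \<le> card ({..<m} \<rightarrow>\<^sub>E ?F)"
  proof (rule card_inj_on_le)
    let ?f = "\<lambda>v. \<lambda>l\<in>{..<m}. trace_map \<Theta> (cs ! l) v"
    show "inj_on ?f V"
    proof (rule inj_onI)
      fix v w assume vw: "v \<in> V" "w \<in> V" "?f v = ?f w"
      have eq: "trace_map \<Theta> (cs ! l) v = trace_map \<Theta> (cs ! l) w" if "l < m" for l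
        using fun_cong[OF vw(3), of l] that by simp
      \<comment> \<open>Equality at the basis \<open>cs\<close> extends to every \<open>x\<close> by
        \<open>K\<close>-linearity; nondegeneracy then gives \<open>v = w\<close>.\<close>
      have "trace_map \<Theta> x (\<lambda>i. v i - w i) = (\<lambda>i. 0)" for x
      proof -
        obtain c where c: "\<forall>k<m. c k \<in> K" "x = (\<Sum>k<m. c k * cs ! k)"
          using cs by blast
        have "trace_map \<Theta> x v = trace_map \<Theta> x w"
          unfolding c(2) by (rule ext) (use c(1) eq in \<open>simp add: trace_map_K_linear\<close>)
        then show ?thesis
          by (simp add: trace_map_diff[OF lin])
      qed
      then have "(\<lambda>i. v i - w i) = (\<lambda>i. 0)"
        by (rule trace_map_nondegenerate)
      then show "v = w"
        by (simp add: fun_eq_iff)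
    qed
    have "trace_map \<Theta> c v \<in> ?F" if "v \<in> V" for c v
      using trace_map_fixed[OF lin order[OF that]] closed pow_V[OF that]
      by (auto simp: trace_map_def)
    then show "?f ` V \<subseteq> {..<m} \<rightarrow>\<^sub>E ?F" by auto
    show "finite ({..<m} \<rightarrow>\<^sub>E ?F)"
      using \<open>finite V\<close> by (intro finite_PiE) auto
  qed
  also have "\<dots> = (q ^ m) ^ ?h"
    using card_E[unfolded bij_betw_same_card[OF L]] by (simp add: card_PiE mult.commute flip: power_mult)
  finally show "card V \<le> (q ^ m) ^ ?h" .
qed

end

section \<open>Ranks over finite fields\<close>

lemma card_carrier_vec:
  "card (carrier_vec n :: 'a::finite vec set) = card (UNIV :: 'a set) ^ n"
proof -
  have "bij_betw (vec n) ({..<n} \<rightarrow>\<^sub>E (UNIV :: 'a set)) (carrier_vec n)"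
  proof (rule bij_betwI')
    fix f g :: "nat \<Rightarrow> 'a"
    assume fg: "f \<in> {..<n} \<rightarrow>\<^sub>E UNIV" "g \<in> {..<n} \<rightarrow>\<^sub>E UNIV"
    show "vec n f = vec n g \<longleftrightarrow> f = g"
    proof
      assume "vec n f = vec n g"
      then have "f i = g i" if "i < n" for i
        using that by (metis index_vec)
      then show "f = g"
        using fg by (intro PiE_ext) auto
    qed simp
  next
    fix v :: "'a vec" assume "v \<in> carrier_vec n"
    then show "\<exists>f\<in>{..<n} \<rightarrow>\<^sub>E UNIV. v = vec n f"
      by (intro bexI[of _ "restrict (($) v) {..<n}"]) auto
  qed simp
  from bij_betw_same_card[OF this] show ?thesis
    by (simp add: card_PiE)
qed

lemma finite_carrier_vec: "finite (carrier_vec n :: 'a::finite vec set)"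
  by (rule card_ge_0_finite) (simp add: card_carrier_vec finite_UNIV_card_ge_0)

text \<open>A maximal independent set of columns has as many elements as the rank and spans the
  column space, so coordinates with respect to it count that space.\<close>

lemma card_col_space:
  fixes A :: "'a::{field,finite} mat"
  assumes A: "A \<in> carrier_mat n nc"
  shows "card (vec_space.col_space n A) = card (UNIV :: 'a set) ^ vec_space.rank n A"
proof -
  interpret vec_space "TYPE('a)" n .
  have cols: "set (cols A) \<subseteq> carrier_vec n"
    using A cols_dim by blast
  let ?P = "\<lambda>T. T \<subseteq> set (cols A) \<and> lin_indpt T"
  have "?P {}"
    by (auto simp: lin_dep_def)
  then obtain S where S: "maximal S ?P"
    using maximal_exists_superset[of "set (cols A)" ?P "{}"] by auto
  then have S_cols: "S \<subseteq> set (cols A)" and indpt: "lin_indpt S"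
    by (auto simp: maximal_def)
  then have finS: "finite S" and SV: "S \<subseteq> carrier_vec n"
    using cols finite_subset by auto
  \<comment> \<open>A column outside the span could be adjoined to \<open>S\<close>, against
    maximality.\<close>
  have "c \<in> span S" if c: "c \<in> set (cols A)" for c
  proof (rule ccontr)
    assume notin: "c \<notin> span S"
    then have "c \<notin> S"
      using span_mem SV by auto
    moreover have "lin_indpt (S \<union> {c})"
      using lin_dep_iff_in_span[OF SV indpt, of c] c cols calculation notin by auto
    then have "?P (insert c S)"
      using c S_cols by simp
    ultimately show False
      using S unfolding maximal_def by blast
  qed
  then have "span (set (cols A)) \<subseteq> span S"
    using span_is_subset[of "set (cols A)" "span S"] span_is_submodule SV by auto
  then have span_eq: "col_space A = span S"
    using span_is_monotone[OF S_cols] by (simp add: col_space_def subset_antisym)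
  have "bij_betw (\<lambda>a. lincomb a S) (S \<rightarrow>\<^sub>E UNIV) (span S)"
  proof (rule bij_betwI')
    fix a b :: "'a vec \<Rightarrow> 'a"
    assume ab: "a \<in> S \<rightarrow>\<^sub>E UNIV" "b \<in> S \<rightarrow>\<^sub>E UNIV"
    show "lincomb a S = lincomb b S \<longleftrightarrow> a = b"
    proof
      assume eq: "lincomb a S = lincomb b S"
      have "lincomb (\<lambda>v. a v - b v) S = 0\<^sub>v n"
      proof (rule eq_vecI)
        fix i assume "i < dim_vec (0\<^sub>v n :: 'a vec)"
        then have i: "i < n" by simp
        have "lincomb a S $ i - lincomb b S $ i = 0"
          using eq by simp
        then show "lincomb (\<lambda>v. a v - b v) S $ i = 0\<^sub>v n $ i"
          using i by (simp add: lincomb_index[OF i SV] left_diff_distrib sum_subtractf)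
      qed (simp add: lincomb_dim[OF finS SV])
      then have "a v - b v = 0" if "v \<in> S" for v
        using lin_dep_crit[OF finS subset_refl, where a = "\<lambda>v. a v - b v" and v = v] that indpt by auto
      then show "a = b"
        using ab by (intro PiE_ext) auto
    qed simp
  next
    fix a assume "a \<in> S \<rightarrow>\<^sub>E (UNIV :: 'a set)"
    then show "lincomb a S \<in> span S"
      using finite_span[OF finS] SV by auto
  next
    fix v assume "v \<in> span S"
    then obtain a where "v = lincomb a S"
      using finite_span[OF finS] SV by auto
    moreover have "lincomb (restrict a S) S = lincomb a S"
      using SV by (intro lincomb_cong) auto
    ultimately show "\<exists>a\<in>S \<rightarrow>\<^sub>E UNIV. v = lincomb a S"
      by (intro bexI[of _ "restrict a S"]) auto
  qed
  from bij_betw_same_card[OF this] show ?thesis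
    using finS by (simp add: span_eq rank_card_indpt[OF A S] card_PiE)
qed

text \<open>Rank-nullity by counting: the nonempty fibres of \<open>x \<mapsto> A x\<close> are
  translates of the kernel, and the image is the column space.\<close>

lemma card_mat_kernel:
  fixes A :: "'a::{field,finite} mat"
  assumes A: "A \<in> carrier_mat n nc"
  shows "card (UNIV :: 'a set) ^ vec_space.rank n A *
    card {x \<in> carrier_vec nc. A *\<^sub>v x = 0\<^sub>v n} = card (UNIV :: 'a set) ^ nc"
proof -
  interpret vec_space "TYPE('a)" n .
  let ?X = "carrier_vec nc :: 'a vec set" and ?ker = "{x \<in> carrier_vec nc. A *\<^sub>v x = 0\<^sub>v n}"
  have fiber: "card {x. x \<in> ?X \<and> A *\<^sub>v x = y} = card (?ker)" if y: "y \<in> (\<lambda>x. A *\<^sub>v x) ` ?X" for y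
  proof -
    obtain x0 where x0: "x0 \<in> ?X" "y = A *\<^sub>v x0"
      using y by auto
    have "bij_betw (\<lambda>k. k + x0) (?ker) {x. x \<in> ?X \<and> A *\<^sub>v x = y}"
    proof (rule bij_betw_byWitness[where f' = "\<lambda>x. x - x0"])
      show "(\<lambda>k. k + x0) ` ?ker \<subseteq> {x. x \<in> ?X \<and> A *\<^sub>v x = y}"
        using x0 A by (auto simp: mult_add_distrib_mat_vec[OF A])
      show "(\<lambda>x. x - x0) ` {x. x \<in> ?X \<and> A *\<^sub>v x = y} \<subseteq> ?ker"
        using x0 A by (auto simp: mult_minus_distrib_mat_vec[OF A])
    qed (use x0 A in auto)
    then show ?thesis
      by (simp add: bij_betw_same_card)
  qed
  have img: "(\<lambda>x. A *\<^sub>v x) ` ?X = col_space A"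
    using A by (auto simp: col_space_eq[OF A])
  have "card ?X = (\<Sum>x\<in>?X. 1)"
    by simp
  also have "\<dots> = (\<Sum>y\<in>(\<lambda>x. A *\<^sub>v x) ` ?X. \<Sum>x\<in>{x. x \<in> ?X \<and> A *\<^sub>v x = y}. 1)"
    by (rule sum.image_gen[OF finite_carrier_vec])
  also have "\<dots> = card (col_space A) * card (?ker)"
    using fiber by (simp add: img)
  finally show ?thesis
    by (simp add: card_carrier_vec card_col_space[OF A])
qed

section \<open>The kernel of the twisted matrix\<close>

lemma comp_funpow_commute:
  assumes "f \<circ> g = g \<circ> f"
  shows "(f ^^ k) ((g ^^ l) x) = (g ^^ l) ((f ^^ k) x)"
proof -
  have fg: "f (g x) = g (f x)" for x
    using assms by (metis comp_apply)
  have "f ((g ^^ l) x) = (g ^^ l) (f x)" for x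
    by (induction l) (simp_all add: fg)
  then show ?thesis
    by (induction k) simp_all
qed

lemma funpow_comp_commute:
  assumes "f \<circ> g = g \<circ> f"
  shows "((f \<circ> g) ^^ k) x = (f ^^ k) ((g ^^ k) x)"
  using comp_funpow_commute[OF assms, of _ 1] comp_funpow_commute[OF assms, of 1]
  by (induction k) simp_all

lemma funpow_fixed: "f x = x \<Longrightarrow> (f ^^ k) x = x"
  by (induction k) simp_all

locale sigma_poly_setup = finite_field_extension q "n * t" K
  for q n t :: nat and K :: "'a::{field,finite} set" +
  fixes u :: nat and b :: "nat \<Rightarrow> 'a"
  assumes n_pos: "0 < n" and t_pos: "0 < t" and u_pos: "0 < u" and coprime: "coprime u n"
begin

lemma frob_mod_t: "frob q (n * (i mod t) + e) (x :: 'a) = frob q (n * i + e) x"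
proof -
  have "n * i + e = (n * (i mod t) + e) + (n * t) * (i div t)"
    using mult_div_mod_eq[of t i] by (metis add.assoc add.commute distrib_left mult.assoc)
  then show ?thesis
    by (simp only: frob_add_mult_m)
qed

lemma frob_mod_t': "frob q (n * (i mod t)) (x :: 'a) = frob q (n * i) x"
  using frob_mod_t[of i 0 x] by simp

definition entry :: "nat \<Rightarrow> nat \<Rightarrow> 'a" where
  "entry i j = frob q (n * i) (b ((j + t - i) mod t))"

text \<open>Column vectors are functions vanishing from \<open>t\<close> on. The vectors
  \<open>(y, y\<^bsup>q^n\<^esup>, y\<^bsup>q^2n\<^esup>, \<dots>)\<close> are the ones fixed by \<open>shift\<close>.\<close>

definition shift :: "(nat \<Rightarrow> 'a) \<Rightarrow> nat \<Rightarrow> 'a" where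
  "shift w i = (if i < t then frob q n (w ((i + (t - 1)) mod t)) else 0)"

text \<open>This is the \<open>\<Psi>\<close> of the introduction, and \<open>shift\<close> is its
  \<open>\<rho>\<close>. The index \<open>(i + (t - 1)) mod t\<close> used there is
  \<open>i - 1\<close> modulo \<open>t\<close> without truncated subtraction.\<close>

definition step :: "(nat \<Rightarrow> 'a) \<Rightarrow> nat \<Rightarrow> 'a" where
  "step w i = (if i < t then frob q u (\<Sum>j<t. entry i j * w j) else 0)"

definition supported :: "(nat \<Rightarrow> 'a) \<Rightarrow> bool" where
  "supported w \<longleftrightarrow> (\<forall>i\<ge>t. w i = 0)"

lemma mod_shift: "i < t \<Longrightarrow> (i + (t - 1)) mod t = (if i = 0 then t - 1 else i - 1)"
  using t_pos by (cases i) (simp_all add: mod_if)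

lemma mod_Suc_shift:
  assumes "i < t"
  shows "((i + (t - 1)) mod t + 1) mod t = i"
  unfolding mod_shift[OF assms] using assms by auto

lemma mod_shift_Suc: "i < t \<Longrightarrow> ((i + 1) mod t + (t - 1)) mod t = i"
  using t_pos by (cases "i + 1 = t") (simp_all add: mod_shift)

text \<open>Each row of \<open>D\<close> is the previous one raised to the power \<open>q^n\<close>
  and shifted cyclically; the last row wraps round to the first because
  \<open>frob q (n * t)\<close> is the identity.\<close>

lemma frob_entry:
  assumes "i < t" "j < t"
  shows "frob q n (entry i j) = entry ((i + 1) mod t) ((j + 1) mod t)"
proof -
  have "((j + 1) mod t + t - (i + 1) mod t) mod t = (j + t - i) mod t"
  proof (cases "i + 1 = t")
    case True
    then have "j + t - i = j + 1" by simp
    then show ?thesis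
      by (simp only: True mod_self diff_zero mod_add_self2 mod_mod_trivial)
  next
    case False
    then have i: "(i + 1) mod t = i + 1"
      using assms by simp
    show ?thesis
    proof (cases "j + 1 = t")
      case True
      then have "j + t - i = t - (i + 1) + t"
        using assms by simp
      then show ?thesis
        by (simp only: True i mod_self add_0 mod_add_self2)
    next
      case False
      then have "(j + 1) mod t = j + 1" "j + 1 + t - (i + 1) = j + t - i"
        using assms by simp_all
      then show ?thesis
        by (simp only: i)
    qed
  qed
  moreover have "n + n * i = n * (i + 1)"
    by simp
  ultimately show ?thesis
    by (simp only: entry_def frob_frob frob_mod_t')
qed

text \<open>By \<open>frob_entry\<close>, Frobenius carries row \<open>i - 1\<close> of
  \<open>D\<close> to row \<open>i\<close> with its columns shifted, and reindexing the sum absorbs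
  that shift.\<close>

lemma step_shift_commute: "step \<circ> shift = shift \<circ> step"
proof (intro ext)
  fix w i
  show "(step \<circ> shift) w i = (shift \<circ> step) w i"
  proof (cases "i < t")
    case True
    let ?i = "(i + (t - 1)) mod t"
    have entry_shift: "frob q n (entry ?i j) = entry i ((j + 1) mod t)" if "j < t" for j
      using frob_entry[of ?i j] that t_pos by (simp only: mod_Suc_shift[OF True] mod_less_divisor)
    have "(\<Sum>j<t. frob q n (entry ?i j) * frob q n (w j)) =
        (\<Sum>j<t. entry i ((j + 1) mod t) * frob q n (w j))"
      by (intro sum.cong) (simp_all only: lessThan_iff entry_shift)
    also have "\<dots> = (\<Sum>j<t. entry i j * shift w j)"
      by (rule sum.reindex_bij_witness[of _ "\<lambda>j. (j + (t - 1)) mod t" "\<lambda>j. (j + 1) mod t"])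
        (use t_pos in \<open>simp_all only: lessThan_iff mod_Suc_shift mod_shift_Suc shift_def mod_less_divisor if_True\<close>)
    finally have eq: "frob q n (\<Sum>j<t. entry ?i j * w j) = (\<Sum>j<t. entry i j * shift w j)"
      by (simp add: frob_sum frob_mult)
    have "shift (step w) i = frob q u (frob q n (\<Sum>j<t. entry ?i j * w j))"
      using True t_pos by (simp add: shift_def[of "step w"] step_def frob_frob add.commute)
    moreover have "step (shift w) i = frob q u (\<Sum>j<t. entry i j * shift w j)"
      using True by (simp add: step_def)
    ultimately show ?thesis
      by (simp only: comp_apply eq)
  qed (simp add: step_def shift_def)
qed

lemma semilinear_shift: "semilinear q n shift"
  by (auto simp: semilinear_def shift_def fun_eq_iff frob_sum frob_mult)

lemma semilinear_step: "semilinear q u step"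
proof -
  have "(\<Sum>j<t. entry i j * (\<Sum>k<N. c k * w k j)) = (\<Sum>k<N. c k * (\<Sum>j<t. entry i j * w k j))"
    for N :: nat and c w i
    by (simp add: sum_distrib_left mult.left_commute) (rule sum.swap)
  then show ?thesis
    by (auto simp: semilinear_def step_def fun_eq_iff frob_sum frob_mult)
qed

lemma supported_shift: "supported w \<Longrightarrow> supported (shift w)"
  and supported_step: "supported w \<Longrightarrow> supported (step w)"
  by (simp_all add: supported_def shift_def step_def)

lemma supported_funpow:
  "supported w \<Longrightarrow> supported ((shift ^^ k) w)" "supported w \<Longrightarrow> supported ((step ^^ k) w)"
  by (induction k) (simp_all add: supported_shift supported_step)

lemma funpow_shift:
  assumes "i < t"
  shows "(shift ^^ k) w i = frob q (n * k) (w ((i + k * (t - 1)) mod t))"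
  using assms
proof (induction k arbitrary: i)
  case (Suc k)
  have "((i + (t - 1)) mod t + k * (t - 1)) mod t = (i + Suc k * (t - 1)) mod t"
    by (simp add: mod_add_left_eq add.assoc)
  then show ?case
    using Suc t_pos by (simp add: shift_def frob_frob)
qed simp

lemma funpow_shift_t:
  assumes "supported w"
  shows "(shift ^^ (t * l)) w = w"
proof -
  have "(shift ^^ t) w = w"
  proof
    fix i show "(shift ^^ t) w i = w i"
      using assms supported_funpow(1)[OF assms, of t]
      by (cases "i < t") (simp_all add: funpow_shift supported_def)
  qed
  then show ?thesis
    by (induction l) (simp_all add: funpow_add)
qed

section \<open>The space \<open>V\<close> and its stability under \<open>step\<close> and
  \<open>shift\<close>\<close>

definition V :: "(nat \<Rightarrow> 'a) set" where
  "V = {w. supported w \<and> (step ^^ n) w = (shift ^^ u) w}"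

lemma V_lincomb:
  assumes "\<And>k. k < (N::nat) \<Longrightarrow> w k \<in> V"
  shows "(\<lambda>i. \<Sum>k<N. c k * w k i) \<in> V"
proof -
  have "(step ^^ n) (\<lambda>i. \<Sum>k<N. c k * w k i) = (shift ^^ u) (\<lambda>i. \<Sum>k<N. c k * w k i)"
    using assms
    by (simp add: V_def semilinearD[OF semilinear_funpow[OF semilinear_shift]]
        semilinearD[OF semilinear_funpow[OF semilinear_step]] mult.commute)
  then show ?thesis
    using assms by (auto simp: V_def supported_def)
qed

lemmas funpow_commute = comp_funpow_commute[OF step_shift_commute]

lemma V_step:
  assumes "w \<in> V"
  shows "(step ^^ k) w \<in> V"
proof -
  have "(step ^^ n) ((step ^^ k) w) = (step ^^ k) ((step ^^ n) w)"
    by (rule comp_funpow_commute) simp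
  also have "\<dots> = (shift ^^ u) ((step ^^ k) w)"
    using assms by (simp add: V_def funpow_commute)
  finally show ?thesis
    using assms by (simp add: V_def supported_funpow)
qed

lemma V_shift:
  assumes "w \<in> V"
  shows "(shift ^^ k) w \<in> V"
proof -
  have "(step ^^ n) ((shift ^^ k) w) = (shift ^^ k) ((shift ^^ u) w)"
    using assms by (simp add: V_def funpow_commute)
  also have "\<dots> = (shift ^^ u) ((shift ^^ k) w)"
    by (rule comp_funpow_commute) simp
  finally show ?thesis
    using assms by (simp add: V_def supported_funpow)
qed

lemma V_funpow_step:
  assumes "w \<in> V"
  shows "(step ^^ (n * k)) w = (shift ^^ (u * k)) w"
proof (induction k)
  case (Suc k)
  have "(step ^^ (n * Suc k)) w = (step ^^ n) ((step ^^ (n * k)) w)"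
    by (simp add: funpow_add)
  also have "\<dots> = (shift ^^ (u * k)) ((step ^^ n) w)"
    by (simp add: Suc funpow_commute)
  also have "\<dots> = (shift ^^ (u * k + u)) w"
    using assms by (simp add: V_def funpow_add)
  finally show ?case
    by (simp add: add.commute)
qed simp

text \<open>This is the column \<open>v(y)\<close> of the introduction for
  \<open>y = \<sigma>(x)\<close>, hence the offset \<open>u\<close>.\<close>

definition embed :: "'a \<Rightarrow> nat \<Rightarrow> 'a" where
  "embed x i = (if i < t then frob q (n * i + u) x else 0)"

lemma poly_sigma_poly:
  "poly (sigma_poly q n t u b) x = - x + (\<Sum>i<t. b i * frob q (n * i + u) x)"
  by (simp add: sigma_poly_def poly_sum poly_monom frob_def add.commute)

lemma K_subspace_ker: "K_subspace (ker_poly (sigma_poly q n t u b))"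
proof -
  have "(\<Sum>i<t. b i * frob q (n * i + u) (c * x)) = c * (\<Sum>i<t. b i * frob q (n * i + u) x)"
    if "c \<in> K" for c x
    using that by (simp add: frob_mult frob_K sum_distrib_left mult.left_commute)
  then show ?thesis
    by (auto simp: K_subspace_def ker_poly_def poly_sigma_poly frob_add distrib_left sum.distrib
        neg_eq_iff_add_eq_0 add_eq_0_iff)
qed

lemma shift_embed: "shift (embed x) = embed x"
proof
  fix i
  have "n + (n * (i + (t - 1)) + u) = n * i + u + n * t * 1"
    using t_pos by (cases t) (simp_all add: algebra_simps)
  then have "frob q n (frob q (n * ((i + (t - 1)) mod t) + u) x) = frob q (n * i + u) x"
    by (simp only: frob_mod_t frob_frob frob_add_mult_m)
  then show "shift (embed x) i = embed x i"
    using t_pos by (simp add: shift_def embed_def)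
qed

text \<open>Row \<open>i\<close> of \<open>D\<close> is the first row shifted and raised to the
  power \<open>q^(n i)\<close>, so it evaluates the same sum, \<open>f(x) + x\<close>, under a power
  of Frobenius. Thus \<open>step\<close> fixes \<open>embed x\<close> exactly when
  \<open>f(x) = 0\<close>.\<close>

lemma step_embed:
  assumes "i < t"
  shows "step (embed x) i = frob q (n * i + u) (poly (sigma_poly q n t u b) x + x)"
proof -
  have "(\<Sum>j<t. entry i j * embed x j) =
      (\<Sum>k<t. frob q (n * i) (b k) * frob q (n * i) (frob q (n * k + u) x))"
  proof (rule sum.reindex_bij_witness[of _ "\<lambda>k. (k + i) mod t" "\<lambda>j. (j + t - i) mod t"])
    fix j assume j: "j \<in> {..<t}"
    then show "((j + t - i) mod t + i) mod t = j"
      using assms by (simp add: mod_add_left_eq)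
    have "n * (i + (j + t - i)) + u = n * j + u + n * t * 1"
      using assms by (simp add: algebra_simps)
    moreover have "frob q (n * i) (frob q (n * ((j + t - i) mod t) + u) x) =
        frob q (n * (i + (j + t - i)) + u) x"
      by (simp only: frob_mod_t frob_frob) (simp add: algebra_simps)
    ultimately have "frob q (n * i) (frob q (n * ((j + t - i) mod t) + u) x) = frob q (n * j + u) x"
      by (simp only: frob_add_mult_m)
    then show "frob q (n * i) (b ((j + t - i) mod t)) *
        frob q (n * i) (frob q (n * ((j + t - i) mod t) + u) x) = entry i j * embed x j"
      using j by (simp add: entry_def embed_def)
  next
    fix k assume "k \<in> {..<t}"
    then show "((k + i) mod t + t - i) mod t = k"
      using assms by (cases "k + i < t") (simp_all add: mod_if)
  qed (use t_pos in auto)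
  then show ?thesis
    using assms by (simp add: step_def poly_sigma_poly frob_sum frob_mult frob_frob add_ac)
qed

lemma exists_Bezout: obtains a c l where "a * u + c * n = 1 + l * (n * t)"
proof -
  obtain a d where "u * a = n * d + gcd u n"
    using bezout_nat[of u n] u_pos by auto
  then have ad: "a * u = 1 + d * n"
    using coprime by (simp add: mult.commute)
  \<comment> \<open>The negative Bezout coefficient \<open>-d\<close> of \<open>n\<close> is
    replaced by the congruent natural number \<open>d * (t - 1)\<close> modulo \<open>t\<close>;
    this alters the sum by a multiple of \<open>n * t\<close>.\<close>
  have "a * u + (d * (t - 1)) * n = 1 + d * n * (1 + (t - 1))"
    by (simp only: ad) (simp add: algebra_simps)
  then have "a * u + (d * (t - 1)) * n = 1 + d * (n * t)"
    using t_pos by simp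
  then show thesis
    by (rule that)
qed

text \<open>Since \<open>\<Theta>\<close> is built from \<open>step\<close> and
  \<open>shift\<close>, and both are powers of \<open>\<Theta>\<close> on \<open>V\<close>, its
  fixed vectors in \<open>V\<close> are their common fixed vectors. These form the image of
  \<open>embed\<close> on \<open>ker f\<close>, so descent applies.\<close>

lemma card_V:
  "card V = (q ^ (n * t)) ^ ring.dim (class_ring :: 'a ring) K (ker_poly (sigma_poly q n t u b))"
  if "finite V"
proof -
  obtain a c l where acl: "a * u + c * n = 1 + l * (n * t)"
    by (rule exists_Bezout)
  define \<Theta> where "\<Theta> = (step ^^ a) \<circ> (shift ^^ c)"
  let ?E = "ker_poly (sigma_poly q n t u b)"
  have comm: "(step ^^ a) \<circ> (shift ^^ c) = (shift ^^ c) \<circ> (step ^^ a)"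
    by (simp add: fun_eq_iff funpow_commute)
  \<comment> \<open>The exponent of \<open>\<Theta>\<close> is \<open>1\<close> only modulo
    \<open>n * t\<close>, which suffices because \<open>frob q (n * t)\<close> is the
    identity.\<close>
  have lin: "semilinear q 1 \<Theta>"
  proof -
    have "semilinear q (1 + n * t * l) \<Theta>"
      using semilinear_comp[OF semilinear_funpow[OF semilinear_step, of a] semilinear_funpow[OF semilinear_shift, of c]]
      by (simp only: acl \<Theta>_def mult.commute[of "n * t"])
    then show ?thesis
      unfolding semilinear_def frob_add_mult_m .
  qed
  have \<Theta>_pow: "(\<Theta> ^^ k) w = (step ^^ (a * k)) ((shift ^^ (c * k)) w)" for k w
    using funpow_comp_commute[OF comm, of k w] by (simp add: \<Theta>_def funpow_mult mult.commute)
  \<comment> \<open>On \<open>V\<close> the powers of \<open>step\<close> become powers of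
    \<open>shift\<close>; the Bezout identity leaves \<open>k\<close> and a multiple of
    \<open>t\<close>, and \<open>shift ^^ t\<close> acts as the identity.\<close>
  have \<Theta>_n: "(\<Theta> ^^ (n * k)) w = (shift ^^ k) w" if w: "w \<in> V" for k w
  proof -
    have "(\<Theta> ^^ (n * k)) w = (shift ^^ (c * (n * k))) ((step ^^ (n * (a * k))) w)"
      by (simp add: \<Theta>_pow funpow_commute mult.left_commute)
    also have "\<dots> = (shift ^^ (c * (n * k) + u * (a * k))) w"
      by (simp add: V_funpow_step[OF w] funpow_add)
    also have "c * (n * k) + u * (a * k) = (a * u + c * n) * k"
      by (simp add: algebra_simps)
    also have "\<dots> = k + t * (l * n * k)"
      by (simp only: acl) (simp add: algebra_simps)
    also have "(shift ^^ \<dots>) w = (shift ^^ k) w"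
      using w by (simp add: funpow_add funpow_shift_t V_def)
    finally show ?thesis .
  qed
  have \<Theta>_u: "(\<Theta> ^^ u) w = step w" if w: "w \<in> V" for w
  proof -
    have "(\<Theta> ^^ u) w = (step ^^ (a * u)) ((step ^^ (n * c)) w)"
      by (simp only: \<Theta>_pow V_funpow_step[OF w, of c] mult.commute[of c u])
    also have "\<dots> = (step ^^ (a * u + c * n)) w"
      by (simp add: funpow_add mult.commute)
    also have "a * u + c * n = 1 + n * (t * l)"
      by (simp only: acl) (simp add: algebra_simps)
    also have "(step ^^ \<dots>) w = step ((shift ^^ (t * (u * l))) w)"
      by (simp add: funpow_add V_funpow_step[OF w] mult.left_commute)
    finally show ?thesis
      using w by (simp add: funpow_shift_t V_def)
  qed
  have fixed: "{w \<in> V. \<Theta> w = w} = {w. supported w \<and> step w = w \<and> shift w = w}"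
  proof (intro Collect_cong iffI)
    fix w assume w: "w \<in> V \<and> \<Theta> w = w"
    then have "(\<Theta> ^^ (n * 1)) w = w" "(\<Theta> ^^ u) w = w"
      by (simp_all only: funpow_fixed)
    then show "supported w \<and> step w = w \<and> shift w = w"
      using w \<Theta>_n[of w 1] \<Theta>_u[of w] by (simp add: V_def)
  next
    fix w assume w: "supported w \<and> step w = w \<and> shift w = w"
    then show "w \<in> V \<and> \<Theta> w = w"
      by (simp add: V_def \<Theta>_def funpow_fixed)
  qed
  have embed_fixed: "supported (embed x) \<and> step (embed x) = embed x \<and> shift (embed x) = embed x"
    if "x \<in> ?E" for x
    using that shift_embed step_embed[of _ x]
    by (auto simp: supported_def embed_def ker_poly_def fun_eq_iff step_def)
  have embed_bij: "bij_betw embed ?E {w \<in> V. \<Theta> w = w}"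
    unfolding fixed
  proof (rule bij_betw_imageI)
    show "inj_on embed ?E"
    proof (rule inj_onI)
      fix x y assume "embed x = embed y"
      then have "embed x 0 = embed y 0" by simp
      then show "x = y"
        using t_pos by (simp add: embed_def)
    qed
    show "embed ` ?E = {w. supported w \<and> step w = w \<and> shift w = w}"
    proof (intro equalityI subsetI)
      fix w assume "w \<in> {w. supported w \<and> step w = w \<and> shift w = w}"
      then have w: "supported w" "step w = w" "shift w = w" by auto
      \<comment> \<open>The preimage of \<open>w 0\<close> under \<open>\<sigma>\<close>: the
        exponent \<open>u * (n * t - 1)\<close> inverts \<open>frob q u\<close>. Invariance under
        \<open>shift\<close> then determines the other coordinates from \<open>w 0\<close>.\<close>
      define x where "x = frob q (u * (n * t - 1)) (w 0)"
      have "u + u * (n * t - 1) = n * t * u"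
        using m_pos by (cases "n * t") (simp_all add: algebra_simps)
      then have x: "frob q u x = w 0"
        by (simp add: x_def frob_frob)
      have "w i = frob q (n * i) (w 0)" if "i < t" for i
        using that
      proof (induction i)
        case (Suc i)
        have "w (Suc i) = shift w (Suc i)"
          by (simp add: w(3))
        also have "\<dots> = frob q n (w i)"
          using Suc.prems mod_shift[of "Suc i"] by (simp add: shift_def)
        finally show ?case
          using Suc by (simp add: frob_frob)
      qed simp
      then have w_eq: "w = embed x"
        using w(1) by (auto simp: embed_def fun_eq_iff supported_def frob_frob simp flip: x)
      moreover have "step (embed x) 0 = embed x 0"
        using w(2) w_eq by simp
      then have "x \<in> ?E"
        using t_pos by (simp add: step_embed ker_poly_def) (simp add: embed_def)
      ultimately show "w \<in> embed ` ?E" by blast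
    qed (use embed_fixed in auto)
  qed
  show ?thesis
  proof (rule card_eq_card_fixed_power[OF that lin V_lincomb _ _ K_subspace_ker embed_bij])
    show "\<Theta> w \<in> V" if "w \<in> V" for w
      using that by (simp add: \<Theta>_def V_step V_shift)
    show "(\<Theta> ^^ (n * t)) w = w" if "w \<in> V" for w
      using \<Theta>_n[OF that, of t] funpow_shift_t[of w 1] that by (simp add: V_def)
    show "embed (\<Sum>k<N. c k * x k) = (\<lambda>i. \<Sum>k<N. c k * embed (x k) i)"
      if "\<And>k. k < N \<Longrightarrow> c k \<in> K \<and> x k \<in> ?E" for N :: nat and c x
      using that by (auto simp: embed_def fun_eq_iff frob_sum frob_mult frob_K)
  qed
qed

section \<open>The matrix of the theorem in terms of \<open>step\<close> and
  \<open>shift\<close>\<close>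

lemma entry_D_mat: "i < t \<Longrightarrow> j < t \<Longrightarrow> D_mat q n t b $$ (i, j) = entry i j"
  by (simp add: D_mat_def entry_def frob_def)

lemma J_mat_pow_mult_vec: "J_mat t ^\<^sub>m k *\<^sub>v vec t w = vec t (\<lambda>i. w ((i + k) mod t) :: 'a)"
proof (induction k arbitrary: w)
  case 0
  show ?case
    by (auto simp: J_mat_def)
next
  case (Suc k)
  have J: "J_mat t \<in> carrier_mat t t"
    by (simp add: J_mat_def)
  have "J_mat t *\<^sub>v vec t w = vec t (\<lambda>i. w ((i + 1) mod t))"
  proof (rule eq_vecI)
    fix i assume "i < dim_vec (vec t (\<lambda>i. w ((i + 1) mod t)))"
    then have i: "i < t" by simp
    have "(J_mat t *\<^sub>v vec t w) $ i = (\<Sum>j<t. (if j = (i + 1) mod t then 1 else 0) * w j)"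
      using i by (auto simp: J_mat_def scalar_prod_def atLeast0LessThan intro!: sum.cong)
    also have "\<dots> = (\<Sum>j<t. if j = (i + 1) mod t then w j else 0)"
      by (intro sum.cong) auto
    finally show "(J_mat t *\<^sub>v vec t w) $ i = vec t (\<lambda>i. w ((i + 1) mod t)) $ i"
      using i t_pos by simp
  qed (simp add: J_mat_def)
  moreover have "J_mat t ^\<^sub>m Suc k *\<^sub>v vec t w = J_mat t ^\<^sub>m k *\<^sub>v (J_mat t *\<^sub>v vec t w)"
    by (simp add: assoc_mult_mat_vec[OF pow_carrier_mat[OF J] J])
  ultimately show ?case
    by (simp add: Suc mod_add_left_eq) (simp add: mod_Suc_eq)
qed

text \<open>The hypothesis on \<open>s + u\<close> makes \<open>\<tau>\<close> inverse to
  \<open>\<sigma>\<close>, so \<open>D w = \<tau>(\<Psi> w)\<close>. Applying \<open>D\<close>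
  twisted by \<open>\<tau> ^^ k\<close> to \<open>\<tau>^k(w')\<close> gives
  \<open>\<tau>^k(D w')\<close>, so each factor adds one \<open>\<tau>\<close> and one
  \<open>\<Psi>\<close>.\<close>

lemma twisted_prod_mult_vec:
  assumes tau: "\<tau> = frob q s" and su: "s + u = n * t * l"
  shows "twisted_prod \<tau> (D_mat q n t b) k *\<^sub>v vec t w = vec t (\<lambda>i. frob q (s * k) ((step ^^ k) w i))"
proof (induction k)
  case 0
  show ?case
    by (auto simp: D_mat_def)
next
  case (Suc k)
  let ?D = "D_mat q n t b" and ?w = "(step ^^ k) w"
  have D: "?D \<in> carrier_mat t t"
    by (simp add: D_mat_def)
  have map_D: "map_mat f ?D \<in> carrier_mat t t" for f :: "'a \<Rightarrow> 'a"
    using D by simp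
  have carrier: "twisted_prod \<tau> ?D k \<in> carrier_mat t t" for k
    using D by (induction k) auto
  have "twisted_prod \<tau> ?D (Suc k) *\<^sub>v vec t w =
      map_mat (\<tau> ^^ k) ?D *\<^sub>v vec t (\<lambda>i. frob q (s * k) (?w i))"
    using assoc_mult_mat_vec[OF map_D carrier, of "vec t w"] Suc by simp
  also have "\<dots> = vec t (\<lambda>i. frob q (s * k) (\<Sum>j<t. entry i j * ?w j))"
  proof (rule eq_vecI)
    fix i assume "i < dim_vec (vec t (\<lambda>i. frob q (s * k) (\<Sum>j<t. entry i j * ?w j)))"
    then have i: "i < t" by simp
    then have "(map_mat (\<tau> ^^ k) ?D *\<^sub>v vec t (\<lambda>i. frob q (s * k) (?w i))) $ i =
        (\<Sum>j<t. frob q (s * k) (entry i j) * frob q (s * k) (?w j))"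
      using D by (auto simp: scalar_prod_def atLeast0LessThan tau frob_funpow entry_D_mat intro!: sum.cong)
    then show "(map_mat (\<tau> ^^ k) ?D *\<^sub>v vec t (\<lambda>i. frob q (s * k) (?w i))) $ i =
        vec t (\<lambda>i. frob q (s * k) (\<Sum>j<t. entry i j * ?w j)) $ i"
      using i by (simp add: frob_sum frob_mult)
  qed (use D in simp)
  also have "\<dots> = vec t (\<lambda>i. frob q (s * Suc k) (step ?w i))"
  proof (rule eq_vecI)
    have "s * Suc k + u = s * k + n * t * l"
      using su by simp
    then show "vec t (\<lambda>i. frob q (s * k) (\<Sum>j<t. entry i j * ?w j)) $ i =
        vec t (\<lambda>i. frob q (s * Suc k) (step ?w i)) $ i" if "i < dim_vec (vec t (\<lambda>i. frob q (s * Suc k) (step ?w i)))" for i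
      using that by (simp add: step_def frob_frob del: mult_Suc_right)
  qed simp
  finally show ?case by simp
qed

text \<open>Cancelling \<open>\<tau>^n\<close> puts \<open>frob q (n * u)\<close> on the other side,
  which is the twist of \<open>shift ^^ u\<close>. The indices agree too: \<open>J^s\<close> moves
  by \<open>s\<close>, \<open>shift ^^ u\<close> by \<open>-u\<close>, and \<open>t\<close> divides
  \<open>s + u\<close>.\<close>

lemma kernel_iff_V:
  assumes tau: "\<tau> = frob q s" and su: "s + u = n * t * l" and w: "supported w"
  shows "(twisted_prod \<tau> (D_mat q n t b) n - J_mat t ^\<^sub>m s) *\<^sub>v vec t w = 0\<^sub>v t \<longleftrightarrow> w \<in> V"
proof -
  let ?T = "twisted_prod \<tau> (D_mat q n t b) n" and ?J = "J_mat t ^\<^sub>m s :: 'a mat"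
  have T: "twisted_prod \<tau> (D_mat q n t b) k \<in> carrier_mat t t" for k
    by (induction k) (auto simp: D_mat_def)
  have J: "?J \<in> carrier_mat t t"
    by (rule pow_carrier_mat) (simp add: J_mat_def)
  have ind: "(i + u * (t - 1)) mod t = (i + s) mod t" for i
  proof -
    have "(i + u * (t - 1) + (s + u)) mod t = (i + u * (t - 1)) mod t"
      by (simp add: su mult.assoc mult.left_commute[of n])
    moreover have "i + u * (t - 1) + (s + u) = i + s + t * u"
      using t_pos by (cases t) (simp_all add: algebra_simps)
    ultimately show ?thesis
      by (metis mod_mult_self2)
  qed
  have "n * u + s * n = (s + u) * n"
    by (simp add: algebra_simps)
  then have eq: "n * u + s * n = n * t * (l * n)"
    by (simp only: su mult.assoc)
  have cancel: "frob q (s * n) x = y \<longleftrightarrow> x = frob q (n * u) y" for x y :: 'a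
    using frob_cancel[of "n * u" "frob q (s * n) x" y] by (simp only: frob_frob eq frob_mult_m)
  have "(?T - ?J) *\<^sub>v vec t w = 0\<^sub>v t \<longleftrightarrow> ?T *\<^sub>v vec t w - ?J *\<^sub>v vec t w = 0\<^sub>v t"
    by (simp add: minus_mult_distrib_mat_vec[OF T J])
  also have "\<dots> \<longleftrightarrow> (\<forall>i<t. frob q (s * n) ((step ^^ n) w i) = w ((i + s) mod t))"
    unfolding twisted_prod_mult_vec[OF tau su] J_mat_pow_mult_vec by (auto simp: vec_eq_iff)
  also have "\<dots> \<longleftrightarrow> (\<forall>i<t. (step ^^ n) w i = (shift ^^ u) w i)"
    by (auto simp only: cancel funpow_shift ind)
  also have "\<dots> \<longleftrightarrow> w \<in> V"
    using w supported_funpow[OF w] by (auto simp: V_def fun_eq_iff supported_def not_less) (metis not_less)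
  finally show ?thesis .
qed

lemma bij_betw_V_kernel:
  assumes tau: "\<tau> = frob q s" and su: "s + u = n * t * l"
  shows "bij_betw (vec t) V
    {v \<in> carrier_vec t. (twisted_prod \<tau> (D_mat q n t b) n - J_mat t ^\<^sub>m s) *\<^sub>v v = 0\<^sub>v t}"
proof (rule bij_betwI')
  fix v w assume vw: "v \<in> V" "w \<in> V"
  then have "v i = w i" if "vec t v = vec t w" for i
    using that by (cases "i < t") (auto simp: V_def supported_def dest: arg_cong[of _ _ "\<lambda>v. v $ i"])
  then show "vec t v = vec t w \<longleftrightarrow> v = w" by blast
next
  fix w assume w: "w \<in> V"
  then show "vec t w \<in> {v \<in> carrier_vec t. (twisted_prod \<tau> (D_mat q n t b) n - J_mat t ^\<^sub>m s) *\<^sub>v v = 0\<^sub>v t}"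
    using kernel_iff_V[OF tau su, of w] by (simp add: V_def)
next
  fix v assume v: "v \<in> {v \<in> carrier_vec t. (twisted_prod \<tau> (D_mat q n t b) n - J_mat t ^\<^sub>m s) *\<^sub>v v = 0\<^sub>v t}"
  define w where "w i = (if i < t then v $ i else 0)" for i
  have "vec t w = v"
    using v by (auto simp: w_def)
  moreover have "w \<in> V"
    using kernel_iff_V[OF tau su, of w] v calculation by (simp add: supported_def w_def)
  ultimately show "\<exists>w\<in>V. v = vec t w" by blast
qed

text \<open>The kernel of the matrix has as many elements as \<open>V\<close>; in the counted
  rank-nullity formula, exponents of \<open>q ^ (n * t)\<close> are compared.\<close>

lemma dim_ker_plus_rank:
  assumes tau: "\<tau> = frob q s" and su: "s + u = n * t * l"
  shows "ring.dim (class_ring :: 'a ring) K (ker_poly (sigma_poly q n t u b)) +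
    vec_space.rank t (twisted_prod \<tau> (D_mat q n t b) n - J_mat t ^\<^sub>m s) = t"
proof -
  let ?M = "twisted_prod \<tau> (D_mat q n t b) n - J_mat t ^\<^sub>m s"
  let ?ker = "{v \<in> carrier_vec t. ?M *\<^sub>v v = 0\<^sub>v t}"
  have M: "?M \<in> carrier_mat t t"
    by (intro minus_carrier_mat pow_carrier_mat) (simp add: J_mat_def)
  have "finite V"
    using bij_betw_finite[OF bij_betw_V_kernel[OF tau su]] finite_subset[OF _ finite_carrier_vec]
    by (metis (no_types, lifting) mem_Collect_eq subsetI)
  then have "card ?ker = (q ^ (n * t)) ^ ring.dim (class_ring :: 'a ring) K (ker_poly (sigma_poly q n t u b))"
    using card_V bij_betw_same_card[OF bij_betw_V_kernel[OF tau su]] by simp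
  then have "(q ^ (n * t)) ^ (vec_space.rank t ?M +
      ring.dim (class_ring :: 'a ring) K (ker_poly (sigma_poly q n t u b))) = (q ^ (n * t)) ^ t"
    using card_mat_kernel[OF M] by (simp add: card_UNIV power_add)
  moreover have "1 < q ^ (n * t)"
    using q_gt_1 m_pos by (intro one_less_power) auto
  ultimately show ?thesis
    by (simp add: add.commute)
qed

lemma inverse_frob_u:
  assumes sigma: "\<sigma> = frob q u" and tau: "\<tau> = inv_into UNIV \<sigma>"
    and s: "s = (LEAST s. 1 \<le> s \<and> s \<le> n * t \<and> \<tau> = frob q s)"
  shows "\<tau> = (frob q s :: 'a \<Rightarrow> 'a)" "\<exists>l. s + u = n * t * l"
proof -
  \<comment> \<open>An explicit exponent for \<open>\<sigma>\<close> inverse in the range from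
    \<open>1\<close> to \<open>n * t\<close>, equal to \<open>n * t\<close> if \<open>n * t\<close>
    divides \<open>u\<close>. It shows that the minimum defining \<open>s\<close> is
    attained.\<close>
  let ?s = "n * t - u mod (n * t)"
  have "?s + u = n * t + n * t * (u div (n * t))"
    using mod_less_divisor[OF m_pos, of u] mult_div_mod_eq[of "n * t" u] by linarith
  then have "frob q u (frob q ?s x) = x" for x :: 'a
    by (simp add: frob_frob add.commute[of u])
  then have "\<tau> y = frob q ?s y" for y
    unfolding tau sigma by (intro inv_into_f_eq) (auto simp: inj_on_def)
  then have "\<tau> = frob q ?s" by blast
  then have P: "1 \<le> ?s \<and> ?s \<le> n * t \<and> \<tau> = frob q ?s"
    using mod_less_divisor[OF m_pos, of u] by (intro conjI) linarith+
  show tau_s: "\<tau> = frob q s"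
    using LeastI[of "\<lambda>s. 1 \<le> s \<and> s \<le> n * t \<and> \<tau> = frob q s", OF P] unfolding s by blast
  \<comment> \<open>A Frobenius exponent below \<open>n * t\<close> that acts as the identity is
    \<open>0\<close>, whence \<open>n * t\<close> divides \<open>s + u\<close>.\<close>
  have "frob q ((s + u) mod (n * t)) x = x" for x :: 'a
  proof -
    have "frob q u (\<tau> x) = x"
      using \<open>\<tau> = frob q ?s\<close> \<open>\<And>x. frob q u (frob q ?s x) = x\<close> by simp
    then have "frob q (s + u) x = x"
      by (simp add: tau_s frob_frob add.commute)
    then show ?thesis
      using frob_add_mult_m[of "(s + u) mod (n * t)" "(s + u) div (n * t)" x] by simp
  qed
  then have "(s + u) mod (n * t) = 0"
    using frob_eq_id m_pos by simp
  then show "\<exists>l. s + u = n * t * l"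
    by auto
qed

end

theorem theorem1p6:
  fixes q n t u s :: nat
    and b :: "nat \<Rightarrow> 'a::{field,finite}"
    and K :: "'a set"
    and \<sigma> \<tau> :: "'a \<Rightarrow> 'a"
    and h :: int
  assumes "primepow q"
    and "n > 0" and "t > 0" and "u > 0"
    and "coprime u n"
    and "card (UNIV :: 'a set) = q ^ (n * t)"
    and "subfield K (class_ring :: 'a ring)" and "card K = q"
    and "\<sigma> = frob q u"
    and "\<tau> = inv_into UNIV \<sigma>"
    and "s = (LEAST s. 1 \<le> s \<and> s \<le> n * t \<and> \<tau> = frob q s)"
  shows "int (ring.dim (class_ring :: 'a ring) K (ker_poly (sigma_poly q n t u b))) = h
     \<longleftrightarrow> int (vec_space.rank t (twisted_prod \<tau> (D_mat q n t b) n - J_mat t ^\<^sub>m s)) = int t - h"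
proof -
  interpret sigma_poly_setup q n t K u b
    by (intro sigma_poly_setup.intro finite_field_extension.intro sigma_poly_setup_axioms.intro)
      (use assms in auto)
  obtain l where "s + u = n * t * l"
    using inverse_frob_u(2)[OF assms(9-11)] by blast
  \<comment> \<open>Dimension and rank add up to \<open>t\<close>, which gives the equivalence for
    every integer \<open>h\<close>; both sides fail when \<open>h\<close> is negative or exceeds
    \<open>t\<close>.\<close>
  from dim_ker_plus_rank[OF inverse_frob_u(1)[OF assms(9-11)] this]
  show ?thesis by linarith
qed

end
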